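(* Let $n \ge 1$ and consider a Gallai coloring of the complete graph $K_n$ whose color degrees, with the vertices numbered $1, \dots, n$ in non-decreasing order of color degree, satisfy $d(1) \le d(2) \le \dots \le d(n)$. Define also $d(0) = 0$. Then for each integer $k$ with $1 \le k \le n$, \[ \sum_{i=k}^n \frac{1}{2^{d(i) - d(k-1)}} \ge 1. \]
   Context: A Gallai coloring of the complete graph $K_n$ is an assignment of a color to each edge (with no restriction on the number of colors, and not necessarily proper) such that there is no rainbow (tricolored) triangle, i.e. no triangle whose three edges have three pairwise distinct colors. The color degree $d(i)$ of a vertex $i$ is the number of distinct colors appearing on the edges incident to $i$. *)

theory Defs
  imports Complex_Main
begin

definition complete_edges :: "'v set \<Rightarrow> 'v set set" where
  "complete_edges V = {e. e \<subseteq> V \<and> card e = 2}"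

(* An edge colouring is a function c on vertex sets; only its values on
   complete_edges V matter. *)

definition rainbow_triangle :: "('v set \<Rightarrow> 'c) \<Rightarrow> 'v \<Rightarrow> 'v \<Rightarrow> 'v \<Rightarrow> bool" where
  "rainbow_triangle c x y z \<longleftrightarrow>
     c {x, y} \<noteq> c {y, z} \<and> c {y, z} \<noteq> c {x, z} \<and> c {x, y} \<noteq> c {x, z}"

definition gallai_coloring :: "'v set \<Rightarrow> ('v set \<Rightarrow> 'c) \<Rightarrow> bool" where
  "gallai_coloring V c \<longleftrightarrow>
     (\<forall>x\<in>V. \<forall>y\<in>V. \<forall>z\<in>V.
        x \<noteq> y \<and> y \<noteq> z \<and> x \<noteq> z \<longrightarrow> \<not> rainbow_triangle c x y z)"

definition color_degree :: "'v set \<Rightarrow> ('v set \<Rightarrow> 'c) \<Rightarrow> 'v \<Rightarrow> nat" where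
  "color_degree V c x = card (c ` {e \<in> complete_edges V. x \<in> e})"

end

theory Submission
  imports Defs
begin

text \<open>
  The case \<open>k = 1\<close>, that \<open>2\<close> to the power minus the colour degree sums to at least \<open>1\<close>, is an
  induction along homogeneous sets: if every vertex outside \<open>M\<close> sees \<open>M\<close> in a single colour,
  colour degrees are subadditive with respect to \<open>M\<close> and the contraction of \<open>M\<close> to a point. A
  colour class that is not connected has homogeneous components, and if all colour classes are
  connected there are at most two colours, so that all degrees are at most two.

  For general \<open>k\<close> let \<open>S\<close> be the set of the last vertices and apply the first case to \<open>S\<close>.
  If \<open>x \<in> S\<close> sends \<open>m\<close> distinctly coloured edges to the complement of \<open>S\<close>, the absence of
  rainbow triangles orders their endpoints linearly so that one of them sees all \<open>m\<close> colours.
  Hence \<open>m \<le> d (k - 1)\<close>, and passing from the whole graph to \<open>S\<close> lowers the degree of \<open>x\<close> by at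
  most \<open>d (k - 1)\<close>.
\<close>

section \<open>Colours at a vertex, connectedness and components of a colour class\<close>

definition incident_colors :: "'v set \<Rightarrow> ('v set \<Rightarrow> 'c) \<Rightarrow> 'v \<Rightarrow> 'c set" where
  "incident_colors V c x = (\<lambda>y. c {x, y}) ` (V - {x})"

lemma color_degree_eq_card_incident_colors:
  assumes "x \<in> V"
  shows "color_degree V c x = card (incident_colors V c x)"
proof -
  have "{e \<in> complete_edges V. x \<in> e} = (\<lambda>y. {x, y}) ` (V - {x})"
    using assms by (auto simp: complete_edges_def card_2_iff doubleton_eq_iff)
  then show ?thesis
    by (simp add: color_degree_def incident_colors_def image_image)
qed

lemma finite_incident_colors: "finite V \<Longrightarrow> finite (incident_colors V c x)"
  by (simp add: incident_colors_def)

lemma gallai_coloring_subset: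
  "gallai_coloring V c \<Longrightarrow> W \<subseteq> V \<Longrightarrow> gallai_coloring W c"
  unfolding gallai_coloring_def by blast

lemma gallai_triangle:
  assumes "gallai_coloring V c" "x \<in> V" "y \<in> V" "z \<in> V" "x \<noteq> y" "y \<noteq> z" "x \<noteq> z"
  shows "c {x, y} = c {y, z} \<or> c {y, z} = c {x, z} \<or> c {x, y} = c {x, z}"
  using assms unfolding gallai_coloring_def rainbow_triangle_def by blast

text \<open>Connectedness of the graph of \<open>a\<close>-edges, expressed through cuts: in this
  form it directly supplies an \<open>a\<close>-edge leaving any given proper nonempty set.\<close>

definition color_connected :: "'v set \<Rightarrow> ('v set \<Rightarrow> 'c) \<Rightarrow> 'c \<Rightarrow> bool" where
  "color_connected V c a \<longleftrightarrow>
     (\<forall>A. A \<subseteq> V \<and> A \<noteq> {} \<and> A \<noteq> V \<longrightarrow> (\<exists>x\<in>A. \<exists>y\<in>V - A. c {x, y} = a))"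

lemma color_connectedD:
  assumes "color_connected V c a" "A \<subseteq> V" "A \<noteq> {}" "A \<noteq> V"
  obtains x y where "x \<in> A" "y \<in> V" "y \<notin> A" "c {x, y} = a"
  using assms unfolding color_connected_def by blast

text \<open>The condition \<open>y \<noteq> z\<close> keeps out loops, since \<open>c\<close> is
  arbitrary on singletons.\<close>

definition color_component :: "'v set \<Rightarrow> ('v set \<Rightarrow> 'c) \<Rightarrow> 'c \<Rightarrow> 'v \<Rightarrow> 'v set" where
  "color_component V c a x =
     {(y, z). y \<in> V \<and> z \<in> V \<and> y \<noteq> z \<and> c {y, z} = a}\<^sup>* `` {x}"

lemma color_component_self: "x \<in> color_component V c a x"
  by (simp add: color_component_def)

lemma color_component_step:
  assumes "y \<in> color_component V c a x" "y \<in> V" "z \<in> V" "c {y, z} = a"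
  shows "z \<in> color_component V c a x"
proof (cases "y = z")
  case False
  with assms show ?thesis
    unfolding color_component_def by (auto intro: rtrancl_into_rtrancl)
qed (use assms in simp)

lemma color_component_subset:
  assumes "x \<in> V"
  shows "color_component V c a x \<subseteq> V"
proof
  fix y assume "y \<in> color_component V c a x"
  then have "(x, y) \<in> {(y, z). y \<in> V \<and> z \<in> V \<and> y \<noteq> z \<and> c {y, z} = a}\<^sup>*"
    by (simp add: color_component_def)
  then show "y \<in> V" using assms by induction auto
qed

lemma color_component_eq:
  assumes "y \<in> color_component V c a x"
  shows "color_component V c a y = color_component V c a x"
proof -
  let ?r = "{(y, z). y \<in> V \<and> z \<in> V \<and> y \<noteq> z \<and> c {y, z} = a}"
  have "sym ?r" by (auto simp: sym_def insert_commute)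
  then have "sym (?r\<^sup>*)" by (rule sym_rtrancl)
  moreover have "(x, y) \<in> ?r\<^sup>*" using assms by (simp add: color_component_def)
  ultimately show ?thesis
    unfolding color_component_def by (auto dest: symD intro: rtrancl_trans)
qed

text \<open>Membership in a set that no \<open>a\<close>-edge leaves is constant along
  \<open>a\<close>-paths from \<open>x\<close>. Used contrapositively: a disconnected colour has
  only proper components.\<close>

lemma color_connected_if_color_component_eq:
  assumes "x \<in> V" "color_component V c a x = V"
  shows "color_connected V c a"
  unfolding color_connected_def
proof (intro allI impI; elim conjE; rule ccontr)
  fix A assume A: "A \<subseteq> V" "A \<noteq> {}" "A \<noteq> V"
    and no: "\<not> (\<exists>x\<in>A. \<exists>y\<in>V - A. c {x, y} = a)"
  have "(y \<in> A) = (x \<in> A)" if "y \<in> V" for y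
  proof -
    have "(x, y) \<in> {(y, z). y \<in> V \<and> z \<in> V \<and> y \<noteq> z \<and> c {y, z} = a}\<^sup>*"
      using that assms(2) by (auto simp: color_component_def)
    then show ?thesis
    proof induction
      case (step y z)
      have "c {z, y} = c {y, z}" by (simp add: insert_commute)
      with step no show ?case by auto
    qed simp
  qed
  with A show False by blast
qed

text \<open>If \<open>p q\<close> has colour \<open>a\<close> and neither \<open>u p\<close> nor \<open>u q\<close> does, then these two agree.\<close>

lemma color_component_uniform:
  assumes g: "gallai_coloring V c" and x: "x \<in> V" and u: "u \<in> V"
    and un: "u \<notin> color_component V c a x"
    and p: "p \<in> color_component V c a x" and q: "q \<in> color_component V c a x"
  shows "c {u, p} = c {u, q}"
proof -
  have *: "c {u, y} = c {u, x}" if "y \<in> color_component V c a x" for y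
  proof -
    have "(x, y) \<in> {(y, z). y \<in> V \<and> z \<in> V \<and> y \<noteq> z \<and> c {y, z} = a}\<^sup>*"
      using that by (simp add: color_component_def)
    then show ?thesis
    proof induction
      case (step y z)
      have y: "y \<in> color_component V c a x" and z: "z \<in> color_component V c a x"
        using step.hyps by (auto simp: color_component_def intro: rtrancl_into_rtrancl)
      have yz: "y \<in> V" "z \<in> V" "y \<noteq> z" "c {y, z} = a" using step.hyps by auto
      have "c {u, y} \<noteq> a" "c {u, z} \<noteq> a"
        using color_component_step[OF y yz(1) u] color_component_step[OF z yz(2) u] un
        by (auto simp: insert_commute)
      moreover have "c {u, y} = c {y, z} \<or> c {y, z} = c {u, z} \<or> c {u, y} = c {u, z}"
        using gallai_triangle[OF g u yz(1,2) _ yz(3)] y z un by metis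
      ultimately show ?case using step.IH yz(4) by metis
    qed simp
  qed
  show ?thesis using *[OF p] *[OF q] by simp
qed

section \<open>Three or more colours force a disconnected colour class\<close>

lemma complete_edges_insert:
  "complete_edges (insert v F) = complete_edges F \<union> (\<lambda>x. {v, x}) ` (F - {v})"
  by (auto simp: complete_edges_def card_2_iff doubleton_eq_iff insert_commute)

lemma pair_in_complete_edges: "x \<in> V \<Longrightarrow> y \<in> V \<Longrightarrow> x \<noteq> y \<Longrightarrow> {x, y} \<in> complete_edges V"
  by (simp add: complete_edges_def)

lemma finite_complete_edges: "finite V \<Longrightarrow> finite (complete_edges V)"
  by (rule finite_subset[of _ "Pow V"]) (auto simp: complete_edges_def)

text \<open>Delete a vertex \<open>v\<close>: if colour \<open>a\<close> becomes disconnected on the rest but is connected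
  on the whole, then \<open>v\<close> sends an \<open>a\<close>-edge to every \<open>a\<close>-component. This forces all edges at
  \<open>v\<close> not coloured \<open>a\<close> to share one colour.\<close>

lemma gallai_exists_disconnected_color:
  assumes "finite V" "gallai_coloring V c" "2 < card (c ` complete_edges V)"
  shows "\<exists>a\<in>c ` complete_edges V. \<not> color_connected V c a"
  using assms
proof (induction V rule: finite_induct)
  case empty
  have "complete_edges ({}::'a set) = {}" by (auto simp: complete_edges_def)
  with empty.prems(2) show ?case by simp
next
  case (insert v F)
  note g = insert.prems(1)
  have gF: "gallai_coloring F c" using g gallai_coloring_subset by blast
  show ?case
  proof (rule ccontr)
    assume "\<not> ?thesis"
    then have conn: "color_connected (insert v F) c a"
      if "a \<in> c ` complete_edges (insert v F)" for a
      using that by blast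
    have fin: "finite (c ` complete_edges (insert v F))"
      using insert.hyps by (simp add: finite_complete_edges)
    have nF: "F \<noteq> {}"
    proof
      assume "F = {}"
      then have "complete_edges (insert v F) = {}"
        by (auto simp: complete_edges_def card_2_iff doubleton_eq_iff)
      with insert.prems(2) show False by simp
    qed
    have at_v: "\<exists>x\<in>F. c {v, x} = a" if a: "a \<in> c ` complete_edges (insert v F)" for a
    proof -
      have "{v} \<noteq> insert v F" using nF insert.hyps(2) by auto
      then obtain x y where "x \<in> {v}" "y \<in> insert v F" "y \<notin> {v}" "c {x, y} = a"
        using color_connectedD[OF conn[OF a], of "{v}"] by blast
      then show ?thesis by auto
    qed
    have two: "\<exists>b1 b2. b1 \<in> c ` complete_edges (insert v F) \<and>
        b2 \<in> c ` complete_edges (insert v F) \<and> b1 \<noteq> a \<and> b2 \<noteq> a \<and> b1 \<noteq> b2" for a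
    proof -
      have "1 < card (c ` complete_edges (insert v F) - {a})"
        using insert.prems(2) fin by (auto simp: card_Diff_singleton_if)
      then obtain b1 b2 where "b1 \<in> c ` complete_edges (insert v F) - {a}"
        "b2 \<in> c ` complete_edges (insert v F) - {a}" "b1 \<noteq> b2"
        by (metis One_nat_def card_le_Suc0_iff_eq finite_Diff fin not_less)
      then show ?thesis by blast
    qed
    show False
    proof (cases "2 < card (c ` complete_edges F)")
      case False
      \<comment> \<open>\<open>F\<close> carries at most two colours, so some colour
        \<open>a\<close> occurs only at \<open>v\<close>. The cut around each single
        \<open>x\<close> then forces \<open>v x\<close> to have colour \<open>a\<close>, leaving no
        other colour at \<open>v\<close>.\<close>
      then obtain a where a: "a \<in> c ` complete_edges (insert v F)" "a \<notin> c ` complete_edges F"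
        by (metis card_mono finite_complete_edges finite_imageI insert.hyps(1)
            insert.prems(2) order_less_le_trans subsetI)
      have all_a: "c {v, x} = a" if x: "x \<in> F" for x
      proof -
        have "{x} \<noteq> insert v F" using x insert.hyps(2) by auto
        then obtain y where y: "y \<in> insert v F" "y \<noteq> x" "c {x, y} = a"
          using color_connectedD[OF conn[OF a(1)], of "{x}"] x by blast
        have "y = v"
          using y a(2) x pair_in_complete_edges[of x F y] by auto
        with y show ?thesis by (simp add: insert_commute)
      qed
      obtain b where "b \<in> c ` complete_edges (insert v F)" "b \<noteq> a" using two[of a] by blast
      then show False using at_v[of b] all_a by metis
    next
      case True
      then obtain a where a: "a \<in> c ` complete_edges F" "\<not> color_connected F c a"
        using insert.IH gF by blast
      then have a': "a \<in> c ` complete_edges (insert v F)"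
        by (auto simp: complete_edges_insert)
      obtain b1 b2 where b: "b1 \<in> c ` complete_edges (insert v F)"
          "b2 \<in> c ` complete_edges (insert v F)" "b1 \<noteq> a" "b2 \<noteq> a" "b1 \<noteq> b2"
        using two[of a] by metis
      obtain x y where x: "x \<in> F" "c {v, x} = b1" and y: "y \<in> F" "c {v, y} = b2"
        using at_v[OF b(1)] at_v[OF b(2)] by metis
      let ?K = "color_component F c a"
      have ne: "?K z \<noteq> F" if "z \<in> F" for z
        using color_connected_if_color_component_eq[OF that, of c a] a(2) by metis
      have hit: "\<exists>p\<in>?K z. c {v, p} = a" if z: "z \<in> F" for z
      proof -
        have "?K z \<subseteq> insert v F" "?K z \<noteq> insert v F" "?K z \<noteq> {}"
          using color_component_subset[OF z, of c a] insert.hyps(2)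
            color_component_self[of z F c a] by auto
        then obtain p w where p: "p \<in> ?K z" "w \<in> insert v F" "w \<notin> ?K z" "c {p, w} = a"
          using color_connectedD[OF conn[OF a'], of "?K z"] by metis
        have "p \<in> F" using p(1) color_component_subset[OF z, of c a] by auto
        then have "w = v" using p color_component_step[OF p(1) _ _ p(4)] by auto
        with p show ?thesis by (metis insert_commute)
      qed
      \<comment> \<open>In the triangle \<open>v p z\<close> only \<open>v p\<close> has colour
        \<open>a\<close>: an \<open>a\<close>-edge \<open>p z\<close> would put \<open>p\<close>
        into the component of \<open>z\<close>. Hence the other two sides agree.\<close>
      have force: "c {p, z} = c {v, z}"
        if "z \<in> F" "c {v, z} \<noteq> a" "p \<in> F" "c {v, p} = a" "p \<notin> ?K z" for p z
      proof -
        have "z \<noteq> p" using that by auto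
        have "c {p, z} \<noteq> a"
          using color_component_step[where c = c, OF color_component_self that(1,3), of a] that(5)
          by (metis insert_commute)
        then show ?thesis
          using gallai_triangle[OF g, of v p z] that \<open>z \<noteq> p\<close> insert.hyps(2)
          by (metis insertCI)
      qed
      show False
      proof (cases "y \<in> ?K x")
        case True
        then have eq: "?K y = ?K x" by (rule color_component_eq)
        \<comment> \<open>The cut around \<open>F - ?K x\<close> yields \<open>p\<close> outside the
          common component with \<open>v p\<close> coloured \<open>a\<close>. By
          \<open>force\<close>, \<open>p\<close> sees \<open>b1\<close> at \<open>x\<close> and
          \<open>b2\<close> at \<open>y\<close>, although it sees the whole component in one
          colour.\<close>
        have "F - ?K x \<noteq> {}" "F - ?K x \<noteq> insert v F"
          using ne[OF x(1)] color_component_subset[OF x(1), of c a] insert.hyps(2) by auto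
        then obtain p w where p: "p \<in> F - ?K x" "w \<in> insert v F" "w \<notin> F - ?K x" "c {p, w} = a"
          using color_connectedD[OF conn[OF a'], of "F - ?K x"] by (metis Diff_subset subset_insertI2)
        have "w \<notin> ?K x"
          using color_component_step[of w F c a x p] p color_component_subset[OF x(1), of c a]
          by (auto simp: insert_commute)
        with p have vp: "c {v, p} = a" by (auto simp: insert_commute)
        have "c {p, x} = b1" "c {p, y} = b2"
          using force[of x p] force[of y p] x y b p vp eq by auto
        moreover have "c {p, x} = c {p, y}"
          using color_component_uniform[OF gF x(1) _ _ color_component_self True, of p] p(1) by simp
        ultimately show False using b by simp
      next
        case False
        have disj: "q \<notin> ?K x" if "q \<in> ?K y" for q
          using color_component_eq[OF that] color_component_eq[of q F c a x] False
            color_component_self[of y F c a] by auto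
        \<comment> \<open>With \<open>p\<close> and \<open>q\<close> the \<open>a\<close>-neighbours
          of \<open>v\<close> in the two components, uniformity makes \<open>q x\<close>,
          \<open>q p\<close> and \<open>p y\<close> equal in colour, while \<open>force\<close>
          gives \<open>b1\<close> for the first and \<open>b2\<close> for the last.\<close>
        obtain p where p: "p \<in> ?K x" "c {v, p} = a" using hit[OF x(1)] by blast
        obtain q where q: "q \<in> ?K y" "c {v, q} = a" using hit[OF y(1)] by blast
        have F: "p \<in> F" "q \<in> F"
          using p(1) q(1) color_component_subset[OF x(1), of c a] color_component_subset[OF y(1), of c a]
          by auto
        have "c {q, x} = b1" "c {p, y} = b2"
          using force[of x q] force[of y p] x y b p q F disj by auto
        moreover have "c {q, x} = c {q, p}"
          using color_component_uniform[OF gF x(1) F(2) disj[OF q(1)] color_component_self p(1)] .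
        moreover have "c {p, q} = c {p, y}"
          using color_component_uniform[OF gF y(1) F(1) _ q(1) color_component_self] disj p(1)
          by blast
        ultimately show False using b by (simp add: insert_commute)
      qed
    qed
  qed
qed

section \<open>Homogeneous sets and the inequality for the whole graph\<close>

text \<open>An edge from \<open>x\<close> out of \<open>M\<close> has the colour of the edge from
  \<open>m\<close> to the same endpoint, so a colour at \<open>x\<close> is seen either inside
  \<open>M\<close> or at \<open>m\<close> in the contraction.\<close>

lemma color_degree_le_module_quotient:
  assumes "M \<subseteq> V" "x \<in> M" "finite V" "m \<in> M"
    and hom: "\<And>u p q. u \<in> V - M \<Longrightarrow> p \<in> M \<Longrightarrow> q \<in> M \<Longrightarrow> c {u, p} = c {u, q}"
  shows "color_degree V c x \<le> color_degree M c x + color_degree (insert m (V - M)) c m"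
proof -
  have "incident_colors V c x \<subseteq> incident_colors M c x \<union> incident_colors (insert m (V - M)) c m"
  proof
    fix a assume "a \<in> incident_colors V c x"
    then obtain y where y: "y \<in> V" "y \<noteq> x" "a = c {x, y}" by (auto simp: incident_colors_def)
    show "a \<in> incident_colors M c x \<union> incident_colors (insert m (V - M)) c m"
    proof (cases "y \<in> M")
      case True
      then show ?thesis using y by (auto simp: incident_colors_def)
    next
      case False
      then have "a = c {m, y}" using hom[of y x m] assms(2,4) y by (auto simp: insert_commute)
      moreover have "y \<noteq> m" using False assms(4) by blast
      ultimately show ?thesis using y False by (auto simp: incident_colors_def)
    qed
  qed
  then have "card (incident_colors V c x)
      \<le> card (incident_colors M c x \<union> incident_colors (insert m (V - M)) c m)"
    using assms(1,3) finite_subset[of M V] by (intro card_mono) (auto simp: finite_incident_colors)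
  also have "\<dots> \<le> card (incident_colors M c x) + card (incident_colors (insert m (V - M)) c m)"
    by (rule card_Un_le)
  finally show ?thesis using assms(1,2,4) by (auto simp: color_degree_eq_card_incident_colors)
qed

text \<open>Two sides of equal colour share a vertex, which sees the other two vertices uniformly.
  This settles order three, where degrees at most two would only give \<open>3/4\<close>.\<close>

lemma gallai_triangle_homogeneous_pair:
  assumes g: "gallai_coloring V c" and V: "V = {x, y, z}" and d: "x \<noteq> y" "y \<noteq> z" "x \<noteq> z"
  shows "\<exists>M m. M \<subseteq> V \<and> m \<in> M \<and> M \<noteq> {m} \<and> M \<noteq> V \<and>
    (\<forall>u\<in>V - M. \<forall>p\<in>M. \<forall>q\<in>M. c {u, p} = c {u, q})"
proof -
  have "c {x, y} = c {y, z} \<or> c {y, z} = c {x, z} \<or> c {x, y} = c {x, z}"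
    using gallai_triangle[OF g] V d by blast
  then consider "c {x, y} = c {y, z}" | "c {y, z} = c {x, z}" | "c {x, y} = c {x, z}" by blast
  then show ?thesis
  proof cases
    case 1
    then show ?thesis
      using d by (intro exI[of _ "{x, z}"] exI[of _ x]) (auto simp: V insert_commute)
  next
    case 2
    then show ?thesis
      using d by (intro exI[of _ "{x, y}"] exI[of _ x]) (auto simp: V insert_commute)
  next
    case 3
    then show ?thesis
      using d by (intro exI[of _ "{y, z}"] exI[of _ y]) (auto simp: V insert_commute)
  qed
qed

text \<open>A homogeneous set is contracted by keeping one of its vertices \<open>m\<close>, so that the
  quotient is again an induced subcolouring and the induction applies to it.\<close>

theorem gallai_sum_power_color_degree_ge_1:
  assumes "finite V" "V \<noteq> {}" "gallai_coloring V c"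
  shows "1 \<le> (\<Sum>x\<in>V. (1 / 2 :: real) ^ color_degree V c x)"
  using assms
proof (induction "card V" arbitrary: V rule: less_induct)
  case less
  note fin = less.prems(1) and g = less.prems(3)
  show ?case
  proof (cases "\<exists>M m. M \<subseteq> V \<and> m \<in> M \<and> M \<noteq> {m} \<and> M \<noteq> V \<and>
      (\<forall>u\<in>V - M. \<forall>p\<in>M. \<forall>q\<in>M. c {u, p} = c {u, q})")
    case True
    then obtain M m where M: "M \<subseteq> V" "m \<in> M" "M \<noteq> {m}" "M \<noteq> V"
      and hom: "\<And>u p q. u \<in> V - M \<Longrightarrow> p \<in> M \<Longrightarrow> q \<in> M \<Longrightarrow> c {u, p} = c {u, q}"
      by metis
    define W where "W = insert m (V - M)"
    have finM: "finite M" and finW: "finite W" using fin M(1) finite_subset by (auto simp: W_def)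
    have "M \<subset> V" using M by blast
    then have "card M < card V" using fin by (rule psubset_card_mono[rotated])
    then have sM: "1 \<le> (\<Sum>x\<in>M. (1 / 2 :: real) ^ color_degree M c x)"
      using less.hyps[of M] finM M gallai_coloring_subset[OF g] by blast
    have "W \<subset> V" using M unfolding W_def by blast
    then have "card W < card V" using fin by (rule psubset_card_mono[rotated])
    moreover have "W \<subseteq> V" "W \<noteq> {}" using \<open>W \<subset> V\<close> by (auto simp: W_def)
    ultimately have sW: "1 \<le> (\<Sum>x\<in>W. (1 / 2 :: real) ^ color_degree W c x)"
      using less.hyps[of W] finW gallai_coloring_subset[OF g] by blast
    \<comment> \<open>The single colour that \<open>u\<close> sends to \<open>M\<close> survives on
      the edge to \<open>m\<close>.\<close>
    have same: "color_degree W c u = color_degree V c u" if u: "u \<in> V - M" for u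
    proof -
      have "incident_colors V c u \<subseteq> incident_colors W c u"
      proof
        fix a assume "a \<in> incident_colors V c u"
        then obtain y where y: "y \<in> V" "y \<noteq> u" "a = c {u, y}"
          by (auto simp: incident_colors_def)
        show "a \<in> incident_colors W c u"
        proof (cases "y \<in> M")
          case True
          then have "a = c {u, m}" using hom[OF u True M(2)] y by simp
          then show ?thesis using u M by (auto simp: incident_colors_def W_def)
        qed (use y in \<open>auto simp: incident_colors_def W_def\<close>)
      qed
      moreover have "incident_colors W c u \<subseteq> incident_colors V c u"
        using \<open>W \<subseteq> V\<close> by (auto simp: incident_colors_def)
      ultimately show ?thesis
        using u by (simp add: color_degree_eq_card_incident_colors W_def)
    qed
    \<comment> \<open>Multiplying the inequality for \<open>M\<close> by the weight of
      \<open>m\<close> and using subadditivity of degrees, the vertices of \<open>M\<close> together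
      weigh at least as much in \<open>V\<close> as \<open>m\<close> does in
      \<open>W\<close>.\<close>
    have "(1 / 2 :: real) ^ color_degree W c m
        \<le> (1 / 2) ^ color_degree W c m * (\<Sum>x\<in>M. (1 / 2) ^ color_degree M c x)"
      using sM by simp
    also have "\<dots> = (\<Sum>x\<in>M. (1 / 2) ^ (color_degree M c x + color_degree W c m))"
      by (simp add: sum_distrib_left power_add mult.commute)
    also have "\<dots> \<le> (\<Sum>x\<in>M. (1 / 2) ^ color_degree V c x)"
      using color_degree_le_module_quotient[where c = c, OF M(1) _ fin M(2) hom]
      by (intro sum_mono power_decreasing) (auto simp: W_def)
    finally have m: "(1 / 2 :: real) ^ color_degree W c m \<le> (\<Sum>x\<in>M. (1 / 2) ^ color_degree V c x)" .
    have "(\<Sum>x\<in>W. (1 / 2 :: real) ^ color_degree W c x)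
        = (1 / 2) ^ color_degree W c m + (\<Sum>x\<in>V - M. (1 / 2) ^ color_degree W c x)"
      using fin M(2) by (subst W_def, subst sum.insert) auto
    also have "(\<Sum>x\<in>V - M. (1 / 2 :: real) ^ color_degree W c x)
        = (\<Sum>x\<in>V - M. (1 / 2) ^ color_degree V c x)"
      by (intro sum.cong) (auto simp: same)
    finally have "1 \<le> (\<Sum>x\<in>M. (1 / 2 :: real) ^ color_degree V c x)
        + (\<Sum>x\<in>V - M. (1 / 2) ^ color_degree V c x)"
      using sW m by simp
    then show ?thesis
      using sum.subset_diff[OF M(1) fin, of "\<lambda>x. (1 / 2 :: real) ^ color_degree V c x"] by simp
  next
    case prime: False
    \<comment> \<open>The component around an \<open>a\<close>-edge has at least two vertices and is
      homogeneous; as no such proper set exists, it must be all of \<open>V\<close>.\<close>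
    have "color_connected V c a" if a: "a \<in> c ` complete_edges V" for a
    proof (rule ccontr)
      assume nc: "\<not> color_connected V c a"
      obtain x y where xy: "x \<in> V" "y \<in> V" "x \<noteq> y" "c {x, y} = a"
        using a by (auto simp: complete_edges_def card_2_iff)
      let ?K = "color_component V c a x"
      have "y \<in> ?K"
        using color_component_step[where c = c, OF color_component_self xy(1,2,4)] .
      then have "?K \<noteq> {x}" using xy(3) by auto
      moreover have "?K \<noteq> V" using nc color_connected_if_color_component_eq[OF xy(1), of c a] by metis
      moreover have "\<forall>u\<in>V - ?K. \<forall>p\<in>?K. \<forall>q\<in>?K. c {u, p} = c {u, q}"
      proof (intro ballI)
        fix u p q assume "u \<in> V - ?K" "p \<in> ?K" "q \<in> ?K"
        then show "c {u, p} = c {u, q}"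
          using color_component_uniform[OF g xy(1), of u a p q] by simp
      qed
      ultimately have "\<exists>M m. M \<subseteq> V \<and> m \<in> M \<and> M \<noteq> {m} \<and> M \<noteq> V \<and>
          (\<forall>u\<in>V - M. \<forall>p\<in>M. \<forall>q\<in>M. c {u, p} = c {u, q})"
        using color_component_subset[OF xy(1), of c a] color_component_self[of x V c a]
        by (intro exI[of _ ?K] exI[of _ x] conjI) assumption+
      with prime show False by (rule notE)
    qed
    then have two: "card (c ` complete_edges V) \<le> 2"
      using gallai_exists_disconnected_color[OF fin g] by (meson not_le)
    have deg2: "color_degree V c x \<le> 2" if "x \<in> V" for x
    proof -
      have "color_degree V c x \<le> card (c ` complete_edges V)"
        unfolding color_degree_def using fin finite_complete_edges[of V] by (intro card_mono) auto
      with two show ?thesis by simp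
    qed
    have deg: "color_degree V c x \<le> card V - 1" if "x \<in> V" for x
      using that fin card_image_le[of "V - {x}" "\<lambda>y. c {x, y}"]
      by (simp add: color_degree_eq_card_incident_colors incident_colors_def)
    \<comment> \<open>At least \<open>2 ^ j\<close> terms, each at least \<open>(1 / 2) ^ j\<close>.
      The values \<open>j = 0, 1, 2\<close> serve orders one, two and at least four.\<close>
    have bound: "1 \<le> (\<Sum>x\<in>V. (1 / 2 :: real) ^ color_degree V c x)"
      if "\<And>x. x \<in> V \<Longrightarrow> color_degree V c x \<le> j" "2 ^ j \<le> card V" for j
    proof -
      have "(2::real) ^ j \<le> real (card V)"
        using that(2) by (metis of_nat_le_iff of_nat_numeral of_nat_power)
      then have "1 \<le> real (card V) * (1 / 2) ^ j" by (simp add: power_one_over field_simps)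
      also have "\<dots> = (\<Sum>x\<in>V. (1 / 2 :: real) ^ j)" by simp
      also have "\<dots> \<le> (\<Sum>x\<in>V. (1 / 2) ^ color_degree V c x)"
        using that(1) by (intro sum_mono power_decreasing) auto
      finally show ?thesis .
    qed
    have "card V \<noteq> 3"
    proof
      assume "card V = 3"
      then obtain x y z where "V = {x, y, z}" "x \<noteq> y" "y \<noteq> z" "x \<noteq> z"
        by (auto simp: card_3_iff)
      then show False using gallai_triangle_homogeneous_pair[OF g, of x y z] prime by blast
    qed
    moreover have "card V \<noteq> 0" using fin less.prems(2) by simp
    ultimately consider "card V = 1" | "card V = 2" | "4 \<le> card V" by linarith
    then show ?thesis
    proof cases
      case 1
      then show ?thesis using bound[of 0] deg by simp
    next
      case 2
      then show ?thesis using bound[of 1] deg by simp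
    next
      case 3
      then show ?thesis using bound[of 2] deg2 by simp
    qed
  qed
qed

section \<open>Restriction to a vertex subset and the general inequality\<close>

text \<open>Each edge inside \<open>R\<close> takes the star colour of one of its ends, which
  orients \<open>R\<close> as a tournament; it is transitive, and \<open>t\<close> is its source. In
  the induction either the old source \<open>s\<close> also beats the new leaf or the new leaf
  replaces it.\<close>

lemma gallai_distinct_star_dominating_leaf:
  assumes "finite R" "R \<noteq> {}" "v \<notin> R" "inj_on (\<lambda>y. c {v, y}) R" "gallai_coloring (insert v R) c"
  shows "\<exists>t\<in>R. \<forall>r\<in>R - {t}. c {t, r} = c {v, r}"
  using assms
proof (induction R rule: finite_ne_induct)
  case (singleton x)
  then show ?case by simp
next
  case (insert t R)
  note g = insert.prems(3)
  have inj: "c {v, x} \<noteq> c {v, y}" if "x \<in> insert t R" "y \<in> insert t R" "x \<noteq> y" for x y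
    using insert.prems(2) that by (meson inj_onD)
  obtain s where s: "s \<in> R" "\<And>r. r \<in> R - {s} \<Longrightarrow> c {s, r} = c {v, r}"
    using insert.IH insert.prems gallai_coloring_subset[OF g, of "insert v R"]
    by (auto simp: inj_on_insert)
  have st: "s \<noteq> t" "v \<noteq> s" "v \<noteq> t" using s insert by auto
  show ?case
  proof (cases "c {s, t} = c {v, t}")
    case True
    then show ?thesis using s by (intro bexI[of _ s]) auto
  next
    case False
    have "c {v, s} = c {s, t} \<or> c {s, t} = c {v, t} \<or> c {v, s} = c {v, t}"
      using gallai_triangle[OF g, of v s t] st s by simp
    then have ts: "c {t, s} = c {v, s}"
      using False inj[of s t] st s by (auto simp: insert_commute)
    \<comment> \<open>The triangle \<open>t s r\<close> leaves the star colours of \<open>s\<close>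
      and \<open>r\<close> for \<open>t r\<close>, the triangle \<open>v t r\<close> those of
      \<open>t\<close> and \<open>r\<close>; only that of \<open>r\<close> is common.\<close>
    have "c {t, r} = c {v, r}" if r: "r \<in> R" "r \<noteq> s" for r
    proof -
      have rt: "r \<noteq> t" "r \<noteq> v" using r insert by auto
      have "c {t, s} = c {s, r} \<or> c {s, r} = c {t, r} \<or> c {t, s} = c {t, r}"
        using gallai_triangle[OF g, of t s r] r rt st s by simp
      moreover have "c {v, t} = c {t, r} \<or> c {t, r} = c {v, r} \<or> c {v, t} = c {v, r}"
        using gallai_triangle[OF g, of v t r] r rt st s by simp
      moreover have "c {s, r} = c {v, r}" using s r by simp
      ultimately show ?thesis
        using ts inj[of s r] inj[of t r] inj[of t s] r rt st s by auto
    qed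
    then show ?thesis using ts by (intro bexI[of _ t]) auto
  qed
qed

text \<open>The colours that \<open>x\<close> sends out of \<open>S\<close> are all seen at one
  vertex outside \<open>S\<close>, so there are at most \<open>D\<close> of them.\<close>

lemma color_degree_le_add:
  assumes fin: "finite V" and g: "gallai_coloring V c" and S: "S \<subseteq> V" "x \<in> S"
    and D: "\<And>t. t \<in> V - S \<Longrightarrow> color_degree V c t \<le> D"
  shows "color_degree V c x \<le> color_degree S c x + D"
proof -
  define N where "N = (\<lambda>y. c {x, y}) ` (V - S)"
  have finN: "finite N" using fin by (simp add: N_def)
  \<comment> \<open>One endpoint is chosen for each colour, so that the edges from \<open>x\<close>
    to \<open>R\<close> form a star with distinct colours.\<close>
  obtain R where R: "R \<subseteq> V - S" "inj_on (\<lambda>y. c {x, y}) R" "N = (\<lambda>y. c {x, y}) ` R"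
    using subset_image_inj[of N "\<lambda>y. c {x, y}" "V - S"] by (auto simp: N_def)
  have "card N \<le> D"
  proof (cases "R = {}")
    case True
    then show ?thesis using R by simp
  next
    case False
    have finR: "finite R" using R(1) fin finite_subset by blast
    have xR: "x \<notin> R" using R(1) S by blast
    have gR: "gallai_coloring (insert x R) c"
      by (rule gallai_coloring_subset[OF g]) (use R(1) S in auto)
    obtain t where t: "t \<in> R" "\<forall>r\<in>R - {t}. c {t, r} = c {x, r}"
      using gallai_distinct_star_dominating_leaf[of R x c, OF finR False xR R(2) gR] by (rule bexE)
    have tV: "t \<in> V - S" using t R by blast
    have "N \<subseteq> incident_colors V c t"
    proof
      fix a assume "a \<in> N"
      then obtain r where r: "r \<in> R" "a = c {x, r}" using R by blast
      show "a \<in> incident_colors V c t"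
      proof (cases "r = t")
        \<comment> \<open>The colour of \<open>x t\<close> itself is seen at \<open>t\<close> on the
          edge back to \<open>x\<close>; all the others come from domination.\<close>
        case True
        then have "a = c {t, x}" using r by (simp add: insert_commute)
        then show ?thesis using S tV by (auto simp: incident_colors_def)
      next
        case False
        then have "a = c {t, r}" using t r by simp
        then show ?thesis using False r R(1) by (auto simp: incident_colors_def)
      qed
    qed
    then have "card N \<le> color_degree V c t"
      using tV fin
      by (simp add: color_degree_eq_card_incident_colors card_mono finite_incident_colors)
    then show ?thesis using D[OF tV] by simp
  qed
  moreover have "incident_colors V c x \<subseteq> incident_colors S c x \<union> N"
    by (auto simp: incident_colors_def N_def)
  then have "card (incident_colors V c x) \<le> card (incident_colors S c x \<union> N)"
    using finN fin S finite_subset[of S V] by (intro card_mono) (auto simp: finite_incident_colors)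
  then have "card (incident_colors V c x) \<le> card (incident_colors S c x) + card N"
    using card_Un_le order_trans by blast
  ultimately show ?thesis
    using S by (auto simp: color_degree_eq_card_incident_colors)
qed

theorem theorem1p3:
  fixes n k :: nat
    and V :: "'v set"
    and c :: "'v set \<Rightarrow> 'c"
    and v :: "nat \<Rightarrow> 'v"
    and d :: "nat \<Rightarrow> nat"
  assumes "n \<ge> 1"
    and "gallai_coloring V c"
    and "bij_betw v {1..n} V"
    and "\<And>i. i \<in> {1..n} \<Longrightarrow> d i = color_degree V c (v i)"
    and "mono_on {1..n} d"
    and "d 0 = 0"
    and "1 \<le> k" and "k \<le> n"
  shows "(\<Sum>i=k..n. 1 / (2::real) powi (int (d i) - int (d (k - 1)))) \<ge> 1"
proof -
  define S where "S = v ` {k..n}"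
  have V: "V = v ` {1..n}" and inj: "inj_on v {1..n}"
    using assms(3) by (auto simp: bij_betw_def)
  have fin: "finite V" by (simp add: V)
  have SV: "S \<subseteq> V" "S \<noteq> {}" using assms(7,8) by (auto simp: S_def V)
  have D: "color_degree V c t \<le> d (k - 1)" if t: "t \<in> V - S" for t
  proof -
    \<comment> \<open>Here \<open>1 \<le> i \<le> k - 1\<close>, so monotonicity applies within
      \<open>{1..n}\<close>; for \<open>k = 1\<close> there is no such \<open>t\<close>.\<close>
    obtain i where i: "i \<in> {1..n}" "t = v i" "i < k" using t by (force simp: V S_def)
    then have "d i \<le> d (k - 1)" using mono_onD[OF assms(5), of i "k - 1"] assms(8) by auto
    then show ?thesis using assms(4)[OF i(1)] i by simp
  qed
  have "1 \<le> (\<Sum>x\<in>S. (1 / 2 :: real) ^ color_degree S c x)"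
    using gallai_sum_power_color_degree_ge_1[of S c] SV fin finite_subset
      gallai_coloring_subset[OF assms(2)] by blast
  also have "\<dots> = (\<Sum>i=k..n. (1 / 2) ^ color_degree S c (v i))"
    unfolding S_def using inj assms(7) by (subst sum.reindex) (auto intro: inj_on_subset)
  also have "\<dots> \<le> (\<Sum>i=k..n. 1 / 2 powi (int (d i) - int (d (k - 1))))"
  proof (rule sum_mono)
    fix i assume i: "i \<in> {k..n}"
    have "color_degree V c (v i) \<le> color_degree S c (v i) + d (k - 1)"
    proof (rule color_degree_le_add[OF fin assms(2) SV(1)])
      show "v i \<in> S" using i by (simp add: S_def)
    qed (rule D)
    then have "d i \<le> color_degree S c (v i) + d (k - 1)"
      using assms(4)[of i] assms(7) i by simp
    then have "(2::real) powi (int (d i) - int (d (k - 1))) \<le> 2 powi int (color_degree S c (v i))"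
      by (intro power_int_increasing) auto
    then show "(1 / 2 :: real) ^ color_degree S c (v i) \<le> 1 / 2 powi (int (d i) - int (d (k - 1)))"
      by (simp add: power_one_over frac_le)
  qed
  finally show ?thesis .
qed

end
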